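(* Let $k\ge3$ and $q=q_1q_2$ with integers $q_1\ge3$ and $q_2\ge2$, and suppose that either $q_2\ge3$, or $q_2=2$ and $k$ is odd. Then there exists a $k$-ary commutative uniquely extendable constraint $\psi$ on a spin set $\Omega$ of size $q$ that is not equivalent to any group constraint function, i.e. there is no group operation $+$ on $\Omega$ and no $b\in\Omega$ such that $\psi=\psi_{(\Omega,+),b}$.
   Context: A $k$-ary constraint on a set $\Omega$ is a map $\psi:\Omega^k\to\{0,1\}$; write $\sigma\models\psi$ if $\psi(\sigma)=1$. $\psi$ is uniquely extendable if for every $i\in[k]$ and every assignment of the other $k-1$ coordinates there is a unique element in coordinate $i$ making the tuple satisfy $\psi$; it is commutative if $\sigma\models\psi\iff(\sigma_{\pi(1)},\dots,\sigma_{\pi(k)})\models\psi$ for all $\sigma\in\Omega^k$ and permutations $\pi$ of $[k]$. For a (not necessarily abelian) group $(\Omega,+)$ and $b\in\Omega$, $\psi_{(\Omega,+),b}$ is the constraint with $(\sigma_1,\dots,\sigma_k)\models\psi_{(\Omega,+),b}$ iff $\sigma_1+\cdots+\sigma_k=b$. *)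

theory Defs
  imports
    "HOL-Library.NList"
    "HOL-Combinatorics.Permutations"
    "HOL-Algebra.Group"
begin

text \<open>
  A tuple in \<open>\<Omega>^k\<close> is a list in \<^term>\<open>nlists k \<Omega>\<close>, with coordinates indexed from \<open>0\<close>.
  A \<open>k\<close>-ary constraint on \<open>\<Omega>\<close> is a Boolean predicate on lists, of which only the values on
  \<^term>\<open>nlists k \<Omega>\<close> matter; \<open>\<psi> \<sigma>\<close> stands for \<open>\<sigma> \<Turnstile> \<psi>\<close>.
\<close>

type_synonym 'a constraint = "'a list \<Rightarrow> bool"

text \<open>
  The \<open>k - 1\<close> prescribed coordinates form the list \<open>\<tau>\<close>, into which \<open>x\<close> is inserted
  as coordinate \<open>i\<close>.
\<close>

definition uniquely_extendable :: "nat \<Rightarrow> 'a set \<Rightarrow> 'a constraint \<Rightarrow> bool" where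
  "uniquely_extendable k \<Omega> \<psi> \<longleftrightarrow>
     (\<forall>i<k. \<forall>\<tau>\<in>nlists (k - 1) \<Omega>. \<exists>!x. x \<in> \<Omega> \<and> \<psi> (take i \<tau> @ x # drop i \<tau>))"

definition commutative :: "nat \<Rightarrow> 'a set \<Rightarrow> 'a constraint \<Rightarrow> bool" where
  "commutative k \<Omega> \<psi> \<longleftrightarrow>
     (\<forall>\<sigma>\<in>nlists k \<Omega>. \<forall>\<pi>. \<pi> permutes {..<k} \<longrightarrow> (\<psi> \<sigma> \<longleftrightarrow> \<psi> (permute_list \<pi> \<sigma>)))"

definition group_constraint :: "('a, 'b) monoid_scheme \<Rightarrow> 'a \<Rightarrow> 'a constraint" where
  "group_constraint G b \<sigma> \<longleftrightarrow> foldr (\<otimes>\<^bsub>G\<^esub>) \<sigma> \<one>\<^bsub>G\<^esub> = b"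

definition equivalent_to_group_constraint :: "nat \<Rightarrow> 'a set \<Rightarrow> 'a constraint \<Rightarrow> bool" where
  "equivalent_to_group_constraint k \<Omega> \<psi> \<longleftrightarrow>
     (\<exists>(G :: 'a monoid) b. group G \<and> carrier G = \<Omega> \<and> b \<in> \<Omega> \<and>
        (\<forall>\<sigma>\<in>nlists k \<Omega>. \<psi> \<sigma> \<longleftrightarrow> group_constraint G b \<sigma>))"

end

theory Submission
  imports Defs "HOL-Number_Theory.Cong"
begin

text \<open>
  A commutative group constraint with \<open>k \<ge> 3\<close> comes from an abelian group. Hence if the entries of
  a \<open>3 \<times> 3\<close> array, extended by a common tuple \<open>\<tau>\<close>, satisfy the constraint along all three rows and
  along two columns, they satisfy it along the third column, as one sees by adding up all nine
  entries by rows and by columns.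

  On \<open>\<int>/q\<^sub>1 \<times> \<int>/q\<^sub>2\<close> consider the constraint \<open>\<Sum> a\<^sub>i = 0\<close> and \<open>\<Sum> c\<^sub>i = f(a\<^sub>1, \<dots>, a\<^sub>k)\<close>, where \<open>f\<close> is \<open>1\<close> if all
  \<open>a\<^sub>i\<close> vanish and \<open>0\<close> otherwise. It is commutative and uniquely extendable. The array with
  \<open>a\<close>-rows \<open>(0,0,0)\<close>, \<open>(1,1,-2)\<close>, \<open>(-1,-1,2)\<close> and \<open>c = 0\<close> except for \<open>c = 1\<close> in the upper right
  corner, together with \<open>\<tau> = 0\<close>, violates the array condition: as \<open>q\<^sub>1 \<ge> 3\<close>, the first row is the
  only line on which \<open>a\<close> vanishes.
\<close>

definition twisted_constraint :: "nat \<Rightarrow> nat \<Rightarrow> nat constraint" where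
  \<comment> \<open>\<open>x < q1 * q2\<close> encodes the pair \<open>(x mod q1, x div q1)\<close>\<close>
  "twisted_constraint q1 q2 \<sigma> \<longleftrightarrow>
     [(\<Sum>x\<leftarrow>\<sigma>. x mod q1) = 0] (mod q1) \<and>
     [(\<Sum>x\<leftarrow>\<sigma>. x div q1) = of_bool (\<forall>x\<in>set \<sigma>. x mod q1 = 0)] (mod q2)"

text \<open>Both sums and the vanishing condition depend only on the multiset of entries. This gives
  commutativity and lets an inserted coordinate be moved to the front.\<close>

lemma twisted_constraint_mset_cong:
  assumes "mset \<sigma> = mset \<tau>"
  shows "twisted_constraint q1 q2 \<sigma> \<longleftrightarrow> twisted_constraint q1 q2 \<tau>"
proof -
  have "sum_list (map f \<sigma>) = sum_list (map f \<tau>)" for f :: "nat \<Rightarrow> nat"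
    using assms by (simp flip: sum_mset_sum_list)
  moreover have "set \<sigma> = set \<tau>"
    using assms by (rule mset_eq_setD)
  ultimately show ?thesis
    by (simp add: twisted_constraint_def)
qed

lemma commutative_if_mset_cong:
  assumes "\<And>\<sigma> \<tau>. mset \<sigma> = mset \<tau> \<Longrightarrow> \<psi> \<sigma> \<longleftrightarrow> \<psi> \<tau>"
  shows "commutative k \<Omega> \<psi>"
  unfolding commutative_def
proof (intro ballI allI impI)
  fix \<sigma> \<pi> assume "\<sigma> \<in> nlists k \<Omega>" and \<pi>: "\<pi> permutes {..<k}"
  then have "length \<sigma> = k"
    by (metis nlistsE_length)
  then have "mset (permute_list \<pi> \<sigma>) = mset \<sigma>"
    using \<pi> by (metis mset_permute_list)
  then show "\<psi> \<sigma> \<longleftrightarrow> \<psi> (permute_list \<pi> \<sigma>)"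
    by (rule assms[OF sym])
qed

lemma ex1_add_cong:
  fixes n s e :: nat
  assumes "n > 0"
  shows "\<exists>!a. a < n \<and> [a + s = e] (mod n)"
proof -
  \<comment> \<open>The witness below replaces \<open>e - s\<close>, which may truncate: modulo
    \<open>n\<close>, \<open>(n - 1) * s\<close> is the negative of \<open>s\<close>.\<close>
  obtain t where t: "[t + s = e] (mod n)"
  proof
    have "e + (n - 1) * s + s = e + n * s"
      using assms by (cases n) (simp_all add: algebra_simps)
    then show "[e + (n - 1) * s + s = e] (mod n)"
      by (simp only: cong_def mod_mult_self2)
  qed
  show ?thesis
  proof (rule ex1I)
    have "[t mod n + s = t + s] (mod n)"
      by (simp add: cong_def mod_simps)
    then show "t mod n < n \<and> [t mod n + s = e] (mod n)"
      using t assms cong_trans by auto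
  next
    fix a assume a: "a < n \<and> [a + s = e] (mod n)"
    then have "[a + s = t + s] (mod n)"
      using t cong_sym cong_trans by metis
    then have "[a = t] (mod n)"
      by (simp add: cong_add_rcancel_nat)
    then show "a = t mod n"
      using a by (simp add: cong_def)
  qed
qed

text \<open>The system is triangular: the first congruence fixes the residue \<open>a\<close> of the
  missing entry. The right-hand side of the second is then a constant, so that congruence fixes the
  quotient \<open>c\<close>.\<close>

lemma uniquely_extendable_twisted_constraint:
  assumes "q1 > 0" "q2 > 0"
  shows "uniquely_extendable k {..<q1 * q2} (twisted_constraint q1 q2)"
  unfolding uniquely_extendable_def
proof (intro allI ballI impI)
  fix i \<tau>
  let ?S = "\<Sum>x\<leftarrow>\<tau>. x mod q1" and ?T = "\<Sum>x\<leftarrow>\<tau>. x div q1"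
  let ?e = "\<lambda>a. of_bool (a = 0 \<and> (\<forall>x\<in>set \<tau>. x mod q1 = 0)) :: nat"
  have "mset (take i \<tau> @ x # drop i \<tau>) = mset (x # \<tau>)" for x
    by (metis append_take_drop_id mset.simps(2) mset_append union_mset_add_mset_right)
  then have eq: "twisted_constraint q1 q2 (take i \<tau> @ x # drop i \<tau>) \<longleftrightarrow>
      [x mod q1 + ?S = 0] (mod q1) \<and> [x div q1 + ?T = ?e (x mod q1)] (mod q2)" for x
    by (subst twisted_constraint_mset_cong[of _ "x # \<tau>"])
      (simp_all only: twisted_constraint_def list.map sum_list.Cons list.set ball_simps)
  obtain a where a: "a < q1" "[a + ?S = 0] (mod q1)"
    and a_unique: "\<And>a'. a' < q1 \<Longrightarrow> [a' + ?S = 0] (mod q1) \<Longrightarrow> a' = a"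
    using ex1_add_cong[OF assms(1), of ?S 0] by blast
  obtain c where c: "c < q2" "[c + ?T = ?e a] (mod q2)"
    and c_unique: "\<And>c'. c' < q2 \<Longrightarrow> [c' + ?T = ?e a] (mod q2) \<Longrightarrow> c' = c"
    using ex1_add_cong[OF assms(2), of ?T "?e a"] by blast
  show "\<exists>!x. x \<in> {..<q1 * q2} \<and> twisted_constraint q1 q2 (take i \<tau> @ x # drop i \<tau>)"
    unfolding eq
  proof (rule ex1I)
    have "c * q1 + a < Suc c * q1"
      using a(1) by simp
    also have "\<dots> \<le> q1 * q2"
      using c(1) by (subst mult.commute) (intro mult_le_mono, auto)
    finally show "c * q1 + a \<in> {..<q1 * q2} \<and>
        [(c * q1 + a) mod q1 + ?S = 0] (mod q1) \<and>
        [(c * q1 + a) div q1 + ?T = ?e ((c * q1 + a) mod q1)] (mod q2)"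
      using a c by simp
  next
    fix x
    assume x: "x \<in> {..<q1 * q2} \<and> [x mod q1 + ?S = 0] (mod q1) \<and>
      [x div q1 + ?T = ?e (x mod q1)] (mod q2)"
    then have "x mod q1 = a"
      using assms(1) by (intro a_unique) auto
    moreover have "x div q1 = c"
      using x \<open>x mod q1 = a\<close> by (intro c_unique) (auto simp: less_mult_imp_div_less mult.commute)
    ultimately show "x = c * q1 + a"
      using div_mult_mod_eq[of x q1] by simp
  qed
qed

lemma (in comm_group) third_column_mult:
  assumes "{x1, y1, z1, x2, y2, z2, x3, y3, z3} \<subseteq> carrier G"
    and "x1 \<otimes> (y1 \<otimes> z1) = d" "x2 \<otimes> (y2 \<otimes> z2) = d" "x3 \<otimes> (y3 \<otimes> z3) = d"
    and "x1 \<otimes> (x2 \<otimes> x3) = d" "y1 \<otimes> (y2 \<otimes> y3) = d"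
  shows "z1 \<otimes> (z2 \<otimes> z3) = d"
proof -
  have d: "d \<in> carrier G"
    using assms(1,2) by auto
  have "d \<otimes> d \<otimes> (z1 \<otimes> (z2 \<otimes> z3)) =
      (x1 \<otimes> (x2 \<otimes> x3)) \<otimes> (y1 \<otimes> (y2 \<otimes> y3)) \<otimes> (z1 \<otimes> (z2 \<otimes> z3))"
    by (simp only: assms)
  also have "\<dots> = (x1 \<otimes> (y1 \<otimes> z1)) \<otimes> (x2 \<otimes> (y2 \<otimes> z2)) \<otimes> (x3 \<otimes> (y3 \<otimes> z3))"
    using assms(1) by (simp add: m_ac)
  also have "\<dots> = d \<otimes> d \<otimes> d"
    by (simp only: assms)
  finally show ?thesis
    using d assms(1) by simp
qed

lemma (in monoid) foldr_mult_closed: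
  "set \<sigma> \<subseteq> carrier G \<Longrightarrow> foldr (\<otimes>) \<sigma> \<one> \<in> carrier G"
  by (induction \<sigma>) auto

text \<open>Absorbing the fixed tail \<tau> into the constant leaves a ternary group equation, whose
  symmetry forces the group to be abelian.\<close>

lemma equivalent_to_group_constraint_third_column:
  assumes "equivalent_to_group_constraint k \<Omega> \<psi>" and "k \<ge> 3"
    and comm: "\<And>\<sigma> \<tau>. mset \<sigma> = mset \<tau> \<Longrightarrow> \<psi> \<sigma> \<longleftrightarrow> \<psi> \<tau>"
    and "set \<tau> \<subseteq> \<Omega>" "length \<tau> = k - 3"
    and elems: "{x1, y1, z1, x2, y2, z2, x3, y3, z3} \<subseteq> \<Omega>"
    and lines: "\<psi> (x1 # y1 # z1 # \<tau>)" "\<psi> (x2 # y2 # z2 # \<tau>)" "\<psi> (x3 # y3 # z3 # \<tau>)"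
      "\<psi> (x1 # x2 # x3 # \<tau>)" "\<psi> (y1 # y2 # y3 # \<tau>)"
  shows "\<psi> (z1 # z2 # z3 # \<tau>)"
proof -
  obtain G :: "'a monoid" and b where "group G" and carrier: "carrier G = \<Omega>" and b: "b \<in> \<Omega>"
    and \<psi>: "\<And>\<sigma>. \<sigma> \<in> nlists k \<Omega> \<Longrightarrow> \<psi> \<sigma> \<longleftrightarrow> group_constraint G b \<sigma>"
    using assms(1) unfolding equivalent_to_group_constraint_def by blast
  interpret group G by fact
  note \<Omega> = carrier[symmetric]
  define t where "t = foldr (\<otimes>\<^bsub>G\<^esub>) \<tau> \<one>\<^bsub>G\<^esub>"
  have t: "t \<in> carrier G"
    unfolding t_def using assms(4) \<Omega> by (intro foldr_mult_closed) simp
  \<comment> \<open>The factor \<open>t\<close> ends the product, so it is cancelled on the right;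
    this is valid before \<open>G\<close> is known to be abelian.\<close>
  define d where "d = b \<otimes>\<^bsub>G\<^esub> inv\<^bsub>G\<^esub> t"
  have d: "d \<in> carrier G"
    using t b by (simp add: d_def \<Omega>)
  have \<psi>_iff: "\<psi> (x # y # z # \<tau>) \<longleftrightarrow> x \<otimes>\<^bsub>G\<^esub> (y \<otimes>\<^bsub>G\<^esub> z) = d"
    if xyz: "x \<in> \<Omega>" "y \<in> \<Omega>" "z \<in> \<Omega>" for x y z
  proof -
    have "x # y # z # \<tau> \<in> nlists k \<Omega>"
      using xyz assms(2,4,5) by (intro nlistsI) simp_all
    then have "\<psi> (x # y # z # \<tau>) \<longleftrightarrow> x \<otimes>\<^bsub>G\<^esub> (y \<otimes>\<^bsub>G\<^esub> (z \<otimes>\<^bsub>G\<^esub> t)) = b"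
      unfolding t_def by (subst \<psi>) (simp_all add: group_constraint_def)
    also have "\<dots> \<longleftrightarrow> x \<otimes>\<^bsub>G\<^esub> (y \<otimes>\<^bsub>G\<^esub> z) \<otimes>\<^bsub>G\<^esub> t = b"
      using xyz t \<Omega> by (simp add: m_assoc)
    also have "\<dots> \<longleftrightarrow> x \<otimes>\<^bsub>G\<^esub> (y \<otimes>\<^bsub>G\<^esub> z) = d"
      using inv_solve_right[of "x \<otimes>\<^bsub>G\<^esub> (y \<otimes>\<^bsub>G\<^esub> z)" b t] xyz t b \<Omega> by (auto simp: d_def)
    finally show ?thesis .
  qed
  have "x \<otimes>\<^bsub>G\<^esub> y = y \<otimes>\<^bsub>G\<^esub> x" if xy: "x \<in> carrier G" "y \<in> carrier G" for x y
  proof -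
    \<comment> \<open>This \<open>z\<close> completes \<open>x\<close>, \<open>y\<close> to a
      solution. Swapping \<open>x\<close> and \<open>y\<close> gives another one, and cancelling
      \<open>z\<close> makes them commute.\<close>
    define z where "z = inv\<^bsub>G\<^esub> (x \<otimes>\<^bsub>G\<^esub> y) \<otimes>\<^bsub>G\<^esub> d"
    have z: "z \<in> carrier G"
      using xy d by (simp add: z_def)
    have xyz: "x \<otimes>\<^bsub>G\<^esub> (y \<otimes>\<^bsub>G\<^esub> z) = d"
      using xy d z unfolding z_def by (simp flip: m_assoc)
    then have "\<psi> (x # y # z # \<tau>)"
      using \<psi>_iff xy z \<Omega> by simp
    then have "\<psi> (y # x # z # \<tau>)"
      using comm[of "x # y # z # \<tau>" "y # x # z # \<tau>"] by (simp add: add_mset_commute)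
    then have "y \<otimes>\<^bsub>G\<^esub> (x \<otimes>\<^bsub>G\<^esub> z) = d"
      using \<psi>_iff xy z \<Omega> by simp
    then have "x \<otimes>\<^bsub>G\<^esub> y \<otimes>\<^bsub>G\<^esub> z = y \<otimes>\<^bsub>G\<^esub> x \<otimes>\<^bsub>G\<^esub> z"
      using xyz xy z by (simp add: m_assoc)
    then show ?thesis
      using xy z by simp
  qed
  then interpret comm_group G
    by (intro group_comm_groupI)
  show ?thesis
    using third_column_mult[of x1 y1 z1 x2 y2 z2 x3 y3 z3 d] lines elems \<Omega> by (simp add: \<psi>_iff)
qed

lemma not_equivalent_twisted_constraint:
  assumes "k \<ge> 3" "q1 \<ge> 3" "q2 \<ge> 2"
  shows "\<not> equivalent_to_group_constraint k {..<q1 * q2} (twisted_constraint q1 q2)"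
proof
  let ?\<psi> = "twisted_constraint q1 q2" and ?\<tau> = "replicate (k - 3) (0::nat)"
  assume eq: "equivalent_to_group_constraint k {..<q1 * q2} ?\<psi>"
  have "q1 * 2 \<le> q1 * q2"
    using assms by simp
  then have less: "x < q1 * q2" if "x \<le> q1" for x
    using that assms by linarith
  have mods: "1 mod q1 = 1" "2 mod q1 = 2" "(q1 - 1) mod q1 = q1 - 1" "(q1 - 2) mod q1 = q1 - 2"
    and divs: "1 div q1 = 0" "2 div q1 = 0" "(q1 - 1) div q1 = 0" "(q1 - 2) div q1 = 0"
    and Suc_Suc: "Suc (Suc (q1 - 2)) = q1"
    using assms by simp_all
  \<comment> \<open>Here \<open>q1\<close> encodes the corner \<open>(0, 1)\<close>, and each
    \<open>x < q1\<close> encodes \<open>(x, 0)\<close>; \<open>q1 - 1\<close> and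
    \<open>q1 - 2\<close> stand for -1 and -2.\<close>
  have "?\<psi> (q1 # (q1 - 2) # 2 # ?\<tau>)"
  proof (rule equivalent_to_group_constraint_third_column[OF eq assms(1) twisted_constraint_mset_cong])
    show "{0, 0, q1, 1, 1, q1 - 2, q1 - 1, q1 - 1, 2} \<subseteq> {..<q1 * q2}" "set ?\<tau> \<subseteq> {..<q1 * q2}"
      using assms less by auto
    \<comment> \<open>The first two columns of the array are equal, hence the repeated goal.\<close>
    show "?\<psi> (0 # 0 # q1 # ?\<tau>)" "?\<psi> (1 # 1 # (q1 - 2) # ?\<tau>)" "?\<psi> ((q1 - 1) # (q1 - 1) # 2 # ?\<tau>)"
      "?\<psi> (0 # 1 # (q1 - 1) # ?\<tau>)" "?\<psi> (0 # 1 # (q1 - 1) # ?\<tau>)"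
      using assms by (simp_all add: twisted_constraint_def sum_list_replicate cong_def mods divs Suc_Suc)
  qed simp_all
  \<comment> \<open>The residue of \<open>2\<close> is nonzero, so the quotients in this column
    should sum to 0 modulo \<open>q2\<close>, but they sum to 1.\<close>
  then show False
    using assms by (simp add: twisted_constraint_def sum_list_replicate cong_def mods divs Suc_Suc)
qed

theorem theorem5p3:
  fixes k q q1 q2 :: nat
  assumes "k \<ge> 3"
    and "q = q1 * q2"
    and "q1 \<ge> 3"
    and "q2 \<ge> 2"
    and "q2 \<ge> 3 \<or> (q2 = 2 \<and> odd k)"
  shows "\<exists>(\<Omega> :: nat set) (\<psi> :: nat constraint).
           finite \<Omega> \<and> card \<Omega> = q \<and>
           commutative k \<Omega> \<psi> \<and>
           uniquely_extendable k \<Omega> \<psi> \<and>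
           \<not> equivalent_to_group_constraint k \<Omega> \<psi>"
proof (intro exI conjI)
  show "commutative k {..<q1 * q2} (twisted_constraint q1 q2)"
    by (intro commutative_if_mset_cong twisted_constraint_mset_cong)
  show "uniquely_extendable k {..<q1 * q2} (twisted_constraint q1 q2)"
    using assms by (intro uniquely_extendable_twisted_constraint) auto
  show "\<not> equivalent_to_group_constraint k {..<q1 * q2} (twisted_constraint q1 q2)"
    using assms by (intro not_equivalent_twisted_constraint)
qed (use assms in simp_all)

end
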